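(* Let $R$ be a ring with unity. The binary relation $\sim$ on $Z(R)$ defined by $$a\sim b \iff a=ub=bv \text{ for some units } u,v\in R$$ is an equivalence relation.
   Context: Rings are associative, not necessarily commutative. $Z(R)$ denotes the set of nonzero zero-divisors of $R$, i.e. nonzero $x\in R$ such that $xy=0$ or $yx=0$ for some nonzero $y\in R$. *)

theory Defs
  imports "HOL-Algebra.Ring"
begin

definition zero_divisors :: "('a, 'm) ring_scheme \<Rightarrow> 'a set" where
  "zero_divisors R =
     {x \<in> carrier R - {\<zero>\<^bsub>R\<^esub>}.
        \<exists>y \<in> carrier R - {\<zero>\<^bsub>R\<^esub>}. x \<otimes>\<^bsub>R\<^esub> y = \<zero>\<^bsub>R\<^esub> \<or> y \<otimes>\<^bsub>R\<^esub> x = \<zero>\<^bsub>R\<^esub>}"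

text \<open>The units \<open>u\<close> and \<open>v\<close> need not be equal; \<^const>\<open>Units\<close> consists of the
  two-sided invertible elements.\<close>

definition unit_rel :: "('a, 'm) ring_scheme \<Rightarrow> ('a \<times> 'a) set" where
  "unit_rel R =
     {(a, b). a \<in> zero_divisors R \<and> b \<in> zero_divisors R \<and>
        (\<exists>u \<in> Units R. \<exists>v \<in> Units R. a = u \<otimes>\<^bsub>R\<^esub> b \<and> a = b \<otimes>\<^bsub>R\<^esub> v)}"

end

theory Submission
  imports Defs
begin

text \<open>The units form a group that acts on the ring by left and by right multiplication.
  \<open>a = u b\<close> says that \<open>a\<close> lies in the left orbit of \<open>b\<close>, and
  \<open>a = b v\<close> that it lies in the right orbit. Lying in one orbit is an equivalence, and
  so is the intersection of two equivalences, restricted to the zero-divisors. Unfolded, the group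
  axioms give the three laws: the identity gives reflexivity, inverses symmetry, products
  transitivity. Each side gets its own witness, since \<open>u\<close> and \<open>v\<close> are
  chosen independently.\<close>

theorem proposition2p4:
  fixes R :: "('a, 'm) ring_scheme"
  assumes "ring R"
  shows "equiv (zero_divisors R) (unit_rel R)"
proof -
  interpret ring R by fact
  have carr: "a \<in> carrier R" if "a \<in> zero_divisors R" for a
    using that by (simp add: zero_divisors_def)
  show ?thesis
  proof (rule equivI)
    show "unit_rel R \<subseteq> zero_divisors R \<times> zero_divisors R"
      unfolding unit_rel_def by blast
    show "refl_on (zero_divisors R) (unit_rel R)"
    proof (rule refl_onI)
      fix a assume a: "a \<in> zero_divisors R"
      have "a = \<one>\<^bsub>R\<^esub> \<otimes>\<^bsub>R\<^esub> a" "a = a \<otimes>\<^bsub>R\<^esub> \<one>\<^bsub>R\<^esub>"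
        using carr[OF a] by simp_all
      with a show "(a, a) \<in> unit_rel R"
        unfolding unit_rel_def using Units_one_closed by blast
    qed
    show "sym (unit_rel R)"
    proof (rule symI)
      fix a b assume "(a, b) \<in> unit_rel R"
      then obtain u v where ab: "a \<in> zero_divisors R" "b \<in> zero_divisors R"
        and uv: "u \<in> Units R" "v \<in> Units R"
        and eq: "a = u \<otimes>\<^bsub>R\<^esub> b" "a = b \<otimes>\<^bsub>R\<^esub> v"
        unfolding unit_rel_def by blast
      \<comment> \<open>Reassociating to the left puts \<open>inv u\<close> next to
        \<open>u\<close>, so they cancel; on the right side below, the brackets move the other way
        to join \<open>v\<close> and \<open>inv v\<close>.\<close>
      have "b = inv\<^bsub>R\<^esub> u \<otimes>\<^bsub>R\<^esub> a"
        unfolding eq(1) using carr[OF ab(2)] uv by (simp add: Units_closed m_assoc[symmetric])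
      moreover have "b = a \<otimes>\<^bsub>R\<^esub> inv\<^bsub>R\<^esub> v"
        unfolding eq(2) using carr[OF ab(2)] uv by (simp add: Units_closed m_assoc)
      ultimately show "(b, a) \<in> unit_rel R"
        unfolding unit_rel_def using ab uv Units_inv_Units by blast
    qed
    show "trans (unit_rel R)"
    proof (rule transI)
      fix a b c assume "(a, b) \<in> unit_rel R" "(b, c) \<in> unit_rel R"
      then obtain u v u' v' where ac: "a \<in> zero_divisors R" "c \<in> zero_divisors R"
        and units: "u \<in> Units R" "v \<in> Units R" "u' \<in> Units R" "v' \<in> Units R"
        and eq: "a = u \<otimes>\<^bsub>R\<^esub> b" "a = b \<otimes>\<^bsub>R\<^esub> v" "b = u' \<otimes>\<^bsub>R\<^esub> c" "b = c \<otimes>\<^bsub>R\<^esub> v'"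
        unfolding unit_rel_def by blast
      have "a = (u \<otimes>\<^bsub>R\<^esub> u') \<otimes>\<^bsub>R\<^esub> c"
        unfolding eq(1) eq(3) using carr[OF ac(2)] units by (simp add: Units_closed m_assoc)
      \<comment> \<open>The order of the factors matters, as the ring need not be commutative: from
        \<open>c\<close> to \<open>a\<close> via \<open>b\<close>, \<open>v'\<close> is applied
        first and so stands nearer to \<open>c\<close>.\<close>
      moreover have "a = c \<otimes>\<^bsub>R\<^esub> (v' \<otimes>\<^bsub>R\<^esub> v)"
        unfolding eq(2) eq(4) using carr[OF ac(2)] units by (simp add: Units_closed m_assoc)
      ultimately show "(a, c) \<in> unit_rel R"
        unfolding unit_rel_def using ac units Units_m_closed by blast
    qed
  qed
qed

end
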